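(* If a restriction functor $\mathsf p:\mathbb E\to\mathbb B$ is an admissible latent fibration, then $\mathsf{Split}_r(\mathsf p):\mathsf{Split}_r(\mathbb E)\to\mathsf{Split}_r(\mathbb B)$ is an admissible latent fibration.
   Context: Composition is written in diagrammatic order. A restriction category is a category with an operation sending each $f:A\to B$ to $\overline f:A\to A$ such that (R.1) $\overline f f=f$; (R.2) $\overline f\,\overline g=\overline g\,\overline f$ for $f,g$ with the same domain; (R.3) $\overline{\overline f g}=\overline f\,\overline g$ for $f,g$ with the same domain; (R.4) $f\overline g=\overline{fg}\,f$ for composable $f,g$. A restriction idempotent is an endomap $e=\overline e$. A restriction functor is a functor preserving restriction. A commuting triangle $kf=g$ (with left factor $k$) is precise if $\overline g=\overline k$. For a restriction functor $\mathsf p:\mathbb E\to\mathbb B$, an arrow $f':X'\to X$ of $\mathbb E$ is $\mathsf p$-prone if whenever $g:Y\to X$ in $\mathbb E$ and $h:\mathsf p(Y)\to\mathsf p(X')$ in $\mathbb B$ are such that $h\,\mathsf p(f')=\mathsf p(g)$ is precise, there is a unique $\widetilde h:Y\to X'$ with $\mathsf p(\widetilde h)=h$ and $\widetilde h f'=g$ precise. $\mathsf p$ is a latent fibration if for each $X\in\mathbb E$ and $f:A\to\mathsf p(X)$ in $\mathbb B$ there is a $\mathsf p$-prone $f':X'\to X$ with $\mathsf p(f')=f$. $\mathsf p$ is admissible if for every $X\in\mathbb E$ and every restriction idempotent $e$ on $\mathsf p(X)$ there is a $\mathsf p$-prone restriction idempotent $e^*$ on $X$ with $\mathsf p(e^*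 )=e$. $\mathsf{Split}_r(\mathbb X)$ is the restriction category whose objects are pairs $(X,e)$ with $e$ a restriction idempotent on $X$, whose maps $f:(X,e)\to(X',e')$ are maps $f:X\to X'$ of $\mathbb X$ with $efe'=f$, with composition and restriction as in $\mathbb X$ and identity $1_{(X,e)}=e$. $\mathsf{Split}_r(\mathsf p)$ sends $(X,e)$ to $(\mathsf p(X),\mathsf p(e))$ and $f$ to $\mathsf p(f)$. *)

theory Defs
  imports Main
begin

text \<open>Composition is in diagrammatic order throughout: \<open>f \<cdot> g\<close> is \<open>f\<close> followed by \<open>g\<close>.\<close>

record ('o, 'm) rcat =
  Obj :: "'o set"
  Arr :: "'m set"
  Dom :: "'m \<Rightarrow> 'o"
  Cod :: "'m \<Rightarrow> 'o"
  Ident :: "'o \<Rightarrow> 'm"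
  Comp :: "'m \<Rightarrow> 'm \<Rightarrow> 'm" (infixl "\<cdot>\<index>" 70)
  Rst :: "'m \<Rightarrow> 'm"

definition Hom :: "('o, 'm) rcat \<Rightarrow> 'o \<Rightarrow> 'o \<Rightarrow> 'm set" where
  "Hom C A B = {f \<in> Arr C. Dom C f = A \<and> Cod C f = B}"

locale category =
  fixes C :: "('o, 'm) rcat" (structure)
  assumes Dom_in_Obj: "f \<in> Arr C \<Longrightarrow> Dom C f \<in> Obj C"
    and Cod_in_Obj: "f \<in> Arr C \<Longrightarrow> Cod C f \<in> Obj C"
    and Ident_in_Hom: "A \<in> Obj C \<Longrightarrow> Ident C A \<in> Hom C A A"
    and Comp_in_Hom: "f \<in> Hom C X Y \<Longrightarrow> g \<in> Hom C Y Z \<Longrightarrow> f \<cdot> g \<in> Hom C X Z"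
    and Ident_left: "f \<in> Hom C X Y \<Longrightarrow> Ident C X \<cdot> f = f"
    and Ident_right: "f \<in> Hom C X Y \<Longrightarrow> f \<cdot> Ident C Y = f"
    and Comp_assoc: "f \<in> Hom C W X \<Longrightarrow> g \<in> Hom C X Y \<Longrightarrow> h \<in> Hom C Y Z \<Longrightarrow>
          (f \<cdot> g) \<cdot> h = f \<cdot> (g \<cdot> h)"

locale restriction_category = category +
  assumes Rst_in_Hom: "f \<in> Hom C X Y \<Longrightarrow> Rst C f \<in> Hom C X X"
    and R1: "f \<in> Hom C X Y \<Longrightarrow> Rst C f \<cdot> f = f"
    and R2: "f \<in> Hom C X Y \<Longrightarrow> g \<in> Hom C X Z \<Longrightarrow> Rst C f \<cdot> Rst C g = Rst C g \<cdot> Rst C f"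
    and R3: "f \<in> Hom C X Y \<Longrightarrow> g \<in> Hom C X Z \<Longrightarrow> Rst C (Rst C f \<cdot> g) = Rst C f \<cdot> Rst C g"
    and R4: "f \<in> Hom C X Y \<Longrightarrow> g \<in> Hom C Y Z \<Longrightarrow> f \<cdot> Rst C g = Rst C (f \<cdot> g) \<cdot> f"

definition restriction_idempotent :: "('o, 'm) rcat \<Rightarrow> 'o \<Rightarrow> 'm \<Rightarrow> bool" where
  "restriction_idempotent C X e \<longleftrightarrow> e \<in> Hom C X X \<and> Rst C e = e"

definition precise :: "('o, 'm) rcat \<Rightarrow> 'm \<Rightarrow> 'm \<Rightarrow> 'm \<Rightarrow> bool" where
  "precise C k f g \<longleftrightarrow> Comp C k f = g \<and> Rst C g = Rst C k"

record ('oe, 'me, 'ob, 'mb) funct =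
  omap :: "'oe \<Rightarrow> 'ob"
  amap :: "'me \<Rightarrow> 'mb"

locale restriction_functor =
  E: restriction_category E + B: restriction_category B
  for E :: "('oe, 'me) rcat" and B :: "('ob, 'mb) rcat" +
  fixes p :: "('oe, 'me, 'ob, 'mb) funct"
  assumes omap_in_Obj: "X \<in> Obj E \<Longrightarrow> omap p X \<in> Obj B"
    and amap_in_Hom: "f \<in> Hom E X Y \<Longrightarrow> amap p f \<in> Hom B (omap p X) (omap p Y)"
    and amap_Ident: "X \<in> Obj E \<Longrightarrow> amap p (Ident E X) = Ident B (omap p X)"
    and amap_Comp: "f \<in> Hom E X Y \<Longrightarrow> g \<in> Hom E Y Z \<Longrightarrow>
          amap p (f \<cdot>\<^bsub>E\<^esub> g) = amap p f \<cdot>\<^bsub>B\<^esub> amap p g"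
    and amap_Rst: "f \<in> Hom E X Y \<Longrightarrow> amap p (Rst E f) = Rst B (amap p f)"

definition prone ::
  "('oe, 'me) rcat \<Rightarrow> ('ob, 'mb) rcat \<Rightarrow> ('oe, 'me, 'ob, 'mb) funct \<Rightarrow> 'oe \<Rightarrow> 'oe \<Rightarrow> 'me \<Rightarrow> bool" where
  "prone E B p X' X f' \<longleftrightarrow>
     f' \<in> Hom E X' X \<and>
     (\<forall>Y \<in> Obj E. \<forall>g \<in> Hom E Y X. \<forall>h \<in> Hom B (omap p Y) (omap p X').
        precise B h (amap p f') (amap p g) \<longrightarrow>
        (\<exists>!k. k \<in> Hom E Y X' \<and> amap p k = h \<and> precise E k f' g))"

definition latent_fibration ::
  "('oe, 'me) rcat \<Rightarrow> ('ob, 'mb) rcat \<Rightarrow> ('oe, 'me, 'ob, 'mb) funct \<Rightarrow> bool" where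
  "latent_fibration E B p \<longleftrightarrow>
     restriction_functor E B p \<and>
     (\<forall>X \<in> Obj E. \<forall>A \<in> Obj B. \<forall>f \<in> Hom B A (omap p X).
        \<exists>X' \<in> Obj E. \<exists>f'. omap p X' = A \<and> prone E B p X' X f' \<and> amap p f' = f)"

definition admissible ::
  "('oe, 'me) rcat \<Rightarrow> ('ob, 'mb) rcat \<Rightarrow> ('oe, 'me, 'ob, 'mb) funct \<Rightarrow> bool" where
  "admissible E B p \<longleftrightarrow>
     restriction_functor E B p \<and>
     (\<forall>X \<in> Obj E. \<forall>e. restriction_idempotent B (omap p X) e \<longrightarrow>
        (\<exists>e'. restriction_idempotent E X e' \<and> prone E B p X X e' \<and> amap p e' = e))"

text \<open>
  An arrow of a category carries its domain and codomain, whereas the same underlying map may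
  represent arrows between several pairs of split objects.  An arrow of the splitting is
  therefore encoded as a triple consisting of its domain, its underlying map and its codomain.
\<close>

definition Split_r ::
  "('o, 'm) rcat \<Rightarrow> ('o \<times> 'm, ('o \<times> 'm) \<times> 'm \<times> ('o \<times> 'm)) rcat" where
  "Split_r C =
     \<lparr> Obj = {(X, e). X \<in> Obj C \<and> restriction_idempotent C X e},
       Arr = {((X, e), f, (X', e')).
                X \<in> Obj C \<and> restriction_idempotent C X e \<and>
                X' \<in> Obj C \<and> restriction_idempotent C X' e' \<and>
                f \<in> Hom C X X' \<and> e \<cdot>\<^bsub>C\<^esub> f \<cdot>\<^bsub>C\<^esub> e' = f},
       Dom = (\<lambda>(s, f, t). s),
       Cod = (\<lambda>(s, f, t). t),
       Ident = (\<lambda>(X, e). ((X, e), e, (X, e))),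
       Comp = (\<lambda>(s, f, t) (s', g, t'). (s, f \<cdot>\<^bsub>C\<^esub> g, t')),
       Rst = (\<lambda>(s, f, t). (s, Rst C f, s)) \<rparr>"

definition Split_r_map ::
  "('oe, 'me, 'ob, 'mb) funct \<Rightarrow>
   ('oe \<times> 'me, ('oe \<times> 'me) \<times> 'me \<times> ('oe \<times> 'me),
    'ob \<times> 'mb, ('ob \<times> 'mb) \<times> 'mb \<times> ('ob \<times> 'mb)) funct" where
  "Split_r_map p =
     \<lparr> omap = (\<lambda>(X, e). (omap p X, amap p e)),
       amap = (\<lambda>((X, e), f, (X', e')).
                 ((omap p X, amap p e), amap p f, (omap p X', amap p e'))) \<rparr>"

end

(* A prone arrow of Split_r E over f : (A,d) -> (pX,pe) is obtained from a prone lift f' : X' -> X of f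
   in E by compressing it to d' f' e, where d' is a restriction idempotent over d.  Lifts k through f'
   are lifts through d' f' e as soon as k d' = k: the remaining conditions are forced by preciseness,
   since Rst k = Rst g is below the domain idempotent and k f' e = Rst (k f' e) k f' = k f'.
   In the latent fibration case k d' = k follows by factoring k through the prone idempotent d'; in the
   admissible case, where f' is itself an idempotent on X and d' = e, it follows from the uniqueness of
   lifts through f'. *)

theory Submission
  imports Defs
begin

section \<open>Restriction idempotents and precise triangles in a restriction category\<close>

context category
begin

lemma Hom_Obj: "f \<in> Hom C X Y \<Longrightarrow> X \<in> Obj C \<and> Y \<in> Obj C"
  using Dom_in_Obj Cod_in_Obj by (auto simp: Hom_def)

end

context restriction_category
begin

lemma restriction_idempotent_Hom: "restriction_idempotent C X e \<Longrightarrow> e \<in> Hom C X X"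
  by (simp add: restriction_idempotent_def)

lemma restriction_idempotent_Rst: "restriction_idempotent C X e \<Longrightarrow> Rst C e = e"
  by (simp add: restriction_idempotent_def)

lemma restriction_idempotent_idem: "restriction_idempotent C X e \<Longrightarrow> e \<cdot> e = e"
  using R1 by (fastforce simp: restriction_idempotent_def)

lemma restriction_idempotent_commute:
  "restriction_idempotent C X d \<Longrightarrow> restriction_idempotent C X e \<Longrightarrow> d \<cdot> e = e \<cdot> d"
  using R2 by (metis restriction_idempotent_def)

lemma Rst_idempotent_Comp:
  "restriction_idempotent C X e \<Longrightarrow> f \<in> Hom C X Y \<Longrightarrow> Rst C (e \<cdot> f) = e \<cdot> Rst C f"
  using R3 by (metis restriction_idempotent_def)

lemma restriction_idempotent_Comp:
  assumes "restriction_idempotent C X d" "restriction_idempotent C X e"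
  shows "restriction_idempotent C X (d \<cdot> e)"
  using assms Rst_idempotent_Comp Comp_in_Hom by (metis restriction_idempotent_def)

text \<open>This is R3 with an identity as second map. The identity is its own restriction, since R1
  and the right unit law compute the same composite.\<close>

lemma Rst_Rst:
  assumes f: "f \<in> Hom C X Y"
  shows "Rst C (Rst C f) = Rst C f"
proof -
  have i: "Ident C X \<in> Hom C X X"
    using Hom_Obj[OF f] Ident_in_Hom by blast
  have r: "Rst C (Ident C X) = Ident C X"
    using R1[OF i] Ident_right[OF Rst_in_Hom[OF i]] by simp
  show ?thesis
    using R3[OF f i] Ident_right[OF Rst_in_Hom[OF f]] r by simp
qed

lemma restriction_idempotent_RstI: "f \<in> Hom C X Y \<Longrightarrow> restriction_idempotent C X (Rst C f)"
  using Rst_in_Hom Rst_Rst by (simp add: restriction_idempotent_def)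

text \<open>R3 merges the two restrictions into that of
  \<open>Rst C f \<cdot> (f \<cdot> g)\<close>, where R1 removes the leading \<open>Rst C f\<close>.
  In the order on restriction idempotents, a composite is defined at most where its first factor
  is.\<close>

lemma Rst_absorb:
  assumes f: "f \<in> Hom C X Y" and g: "g \<in> Hom C Y Z"
  shows "Rst C f \<cdot> Rst C (f \<cdot> g) = Rst C (f \<cdot> g)"
proof -
  have "Rst C f \<cdot> Rst C (f \<cdot> g) = Rst C (Rst C f \<cdot> (f \<cdot> g))"
    using R3 f Comp_in_Hom[OF f g] by metis
  also have "Rst C f \<cdot> (f \<cdot> g) = (Rst C f \<cdot> f) \<cdot> g"
    using Comp_assoc[OF Rst_in_Hom[OF f] f g] by simp
  finally show ?thesis
    using R1[OF f] by simp
qed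

text \<open>Composing the two-sided equation with \<open>e\<close> or \<open>e'\<close> once more
  changes nothing, by idempotency. This replaces the condition on maps of the splitting by two
  one-sided absorption laws, the form used from here on.\<close>

lemma sandwich_iff:
  assumes e: "restriction_idempotent C X e" and e': "restriction_idempotent C Y e'"
    and f: "f \<in> Hom C X Y"
  shows "e \<cdot> f \<cdot> e' = f \<longleftrightarrow> e \<cdot> f = f \<and> f \<cdot> e' = f"
proof
  note eh = restriction_idempotent_Hom[OF e] restriction_idempotent_Hom[OF e']
  note ef = Comp_in_Hom[OF eh(1) f]
  assume *: "e \<cdot> f \<cdot> e' = f"
  have "e \<cdot> (e \<cdot> f \<cdot> e') = e \<cdot> (e \<cdot> f) \<cdot> e'"
    using Comp_assoc[OF eh(1) ef eh(2)] by simp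
  also have "e \<cdot> (e \<cdot> f) = e \<cdot> f"
    using Comp_assoc[OF eh(1) eh(1) f] restriction_idempotent_idem[OF e] by simp
  finally have "e \<cdot> f = f"
    using * by simp
  moreover have "(e \<cdot> f \<cdot> e') \<cdot> e' = e \<cdot> f \<cdot> e'"
    using Comp_assoc[OF ef eh(2) eh(2)] restriction_idempotent_idem[OF e'] by simp
  ultimately show "e \<cdot> f = f \<and> f \<cdot> e' = f"
    using * by simp
qed simp

lemma Rst_below_idempotent:
  assumes e: "restriction_idempotent C X e" and f: "f \<in> Hom C X Y" and ef: "e \<cdot> f = f"
  shows "e \<cdot> Rst C f = Rst C f" "Rst C f \<cdot> e = Rst C f"
  using Rst_idempotent_Comp[OF e f] ef
    restriction_idempotent_commute[OF e restriction_idempotent_RstI[OF f]] by simp_all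

text \<open>Since \<open>k = Rst C k \<cdot> k\<close> and \<open>Rst C k = Rst C g\<close> lies
  below \<open>e\<close>, composing with \<open>e\<close> on the left has no effect. This gives the
  domain condition for a lift \<open>k\<close> of \<open>g\<close> in the splitting.\<close>

lemma precise_left_absorb:
  assumes e: "restriction_idempotent C X e" and g: "g \<in> Hom C X Z" and eg: "e \<cdot> g = g"
    and k: "k \<in> Hom C X Y" and r: "Rst C g = Rst C k"
  shows "e \<cdot> k = k"
proof -
  have "e \<cdot> k = (e \<cdot> Rst C k) \<cdot> k"
    using Comp_assoc[OF restriction_idempotent_Hom[OF e] Rst_in_Hom[OF k] k] R1[OF k] by simp
  then show ?thesis
    using Rst_below_idempotent(1)[OF e g eg] r R1[OF k] by simp
qed

text \<open>By R4 the trailing \<open>e\<close> moves to the front as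
  \<open>Rst C (k \<cdot> f \<cdot> e)\<close>. This equals \<open>Rst C k\<close>, which
  \<open>k\<close> absorbs. A precise factorization through \<open>f \<cdot> e\<close> is thereby
  one through \<open>f\<close>.\<close>

lemma precise_right_absorb:
  assumes f: "f \<in> Hom C Y Z" and k: "k \<in> Hom C X Y" and e: "restriction_idempotent C Z e"
    and r: "Rst C (k \<cdot> (f \<cdot> e)) = Rst C k"
  shows "k \<cdot> f \<cdot> e = k \<cdot> f"
proof -
  note eh = restriction_idempotent_Hom[OF e]
  note kf = Comp_in_Hom[OF k f]
  have "k \<cdot> f \<cdot> e = Rst C (k \<cdot> f \<cdot> e) \<cdot> (k \<cdot> f)"
    using R4[OF kf eh] restriction_idempotent_Rst[OF e] by simp
  also have "\<dots> = Rst C k \<cdot> (k \<cdot> f)"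
    using r Comp_assoc[OF k f eh] by simp
  also have "\<dots> = k \<cdot> f"
    using Comp_assoc[OF Rst_in_Hom[OF k] k f] R1[OF k] by simp
  finally show ?thesis .
qed

text \<open>The restriction of \<open>k \<cdot> d\<close> lies between those of
  \<open>k \<cdot> d \<cdot> f\<close> and \<open>k\<close>, and the hypothesis makes these two
  bounds equal.\<close>

lemma Rst_eq_factor:
  assumes k: "k \<in> Hom C X Y" and d: "d \<in> Hom C Y Z" and f: "f \<in> Hom C Z W"
    and r: "Rst C (k \<cdot> d \<cdot> f) = Rst C k"
  shows "Rst C (k \<cdot> d) = Rst C k"
proof -
  note kd = Comp_in_Hom[OF k d]
  have "Rst C (k \<cdot> d) \<cdot> Rst C k = Rst C k"
    using Rst_absorb[OF kd f] r by simp
  moreover have "Rst C k \<cdot> Rst C (k \<cdot> d) = Rst C (k \<cdot> d)"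
    by (rule Rst_absorb[OF k d])
  ultimately show ?thesis
    using R2[OF k kd] by simp
qed

end

section \<open>The splitting as a restriction category\<close>

lemma Split_r_simps [simp]:
  "Obj (Split_r C) = {(X, e). X \<in> Obj C \<and> restriction_idempotent C X e}"
  "Dom (Split_r C) (s, f, t) = s"
  "Cod (Split_r C) (s, f, t) = t"
  "Ident (Split_r C) (X, e) = ((X, e), e, (X, e))"
  "Comp (Split_r C) (s, f, t) (s', g, t') = (s, Comp C f g, t')"
  "Rst (Split_r C) (s, f, t) = (s, Rst C f, s)"
  by (simp_all add: Split_r_def)

lemma Split_r_map_simps [simp]:
  "omap (Split_r_map p) (X, e) = (omap p X, amap p e)"
  "amap (Split_r_map p) ((X, e), f, (X', e')) = ((omap p X, amap p e), amap p f, (omap p X', amap p e'))"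
  by (simp_all add: Split_r_map_def)

context restriction_category
begin

lemma Hom_Split_r:
  "a \<in> Hom (Split_r C) (X, e) (Y, d) \<longleftrightarrow>
     (\<exists>f. a = ((X, e), f, (Y, d)) \<and> restriction_idempotent C X e \<and> restriction_idempotent C Y d \<and>
          f \<in> Hom C X Y \<and> e \<cdot> f = f \<and> f \<cdot> d = f)"
proof -
  have "a \<in> Hom (Split_r C) (X, e) (Y, d) \<longleftrightarrow>
     (\<exists>f. a = ((X, e), f, (Y, d)) \<and> restriction_idempotent C X e \<and> restriction_idempotent C Y d \<and>
          f \<in> Hom C X Y \<and> e \<cdot> f \<cdot> d = f)"
    unfolding Hom_def[of "Split_r C"] by (cases a) (auto simp: Split_r_def dest: Hom_Obj)
  then show ?thesis
    using sandwich_iff by blast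
qed

lemma Hom_Split_rE:
  assumes "a \<in> Hom (Split_r C) s t"
  obtains X e Y d f where "s = (X, e)" "t = (Y, d)" "a = ((X, e), f, (Y, d))"
    "restriction_idempotent C X e" "restriction_idempotent C Y d"
    "f \<in> Hom C X Y" "e \<cdot> f = f" "f \<cdot> d = f"
  using assms Hom_Split_r by (metis surj_pair)

lemma Hom_Split_rI:
  assumes "restriction_idempotent C X e" "restriction_idempotent C Y d"
    "f \<in> Hom C X Y" "e \<cdot> f = f" "f \<cdot> d = f"
  shows "((X, e), f, (Y, d)) \<in> Hom (Split_r C) (X, e) (Y, d)"
  using assms Hom_Split_r by blast

text \<open>A one-sided condition on \<open>c\<close> suffices because restriction idempotents on
  the same object commute.\<close>

lemma restriction_idempotent_Split_r:
  "restriction_idempotent (Split_r C) (X, e) a \<longleftrightarrow>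
     (\<exists>c. a = ((X, e), c, (X, e)) \<and> restriction_idempotent C X e \<and>
          restriction_idempotent C X c \<and> e \<cdot> c = c)"
  (is "?L \<longleftrightarrow> ?R")
proof
  assume ?L
  then show ?R
    by (auto simp: restriction_idempotent_def[of "Split_r C"] Hom_Split_r)
       (auto simp: restriction_idempotent_def)
next
  assume ?R
  then show ?L
    using restriction_idempotent_commute
    by (fastforce simp: restriction_idempotent_def[of "Split_r C"] Hom_Split_r
        restriction_idempotent_Rst restriction_idempotent_Hom)
qed

lemma restriction_category_Split_r: "restriction_category (Split_r C)"
proof
  fix f assume "f \<in> Arr (Split_r C)"
  then show "Dom (Split_r C) f \<in> Obj (Split_r C)" "Cod (Split_r C) f \<in> Obj (Split_r C)"
    by (auto simp: Split_r_def)
next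
  fix s assume "s \<in> Obj (Split_r C)"
  then show "Ident (Split_r C) s \<in> Hom (Split_r C) s s"
    by (auto simp: Hom_Split_r restriction_idempotent_Hom restriction_idempotent_idem)
next
  fix f g s t u
  assume f: "f \<in> Hom (Split_r C) s t" and g: "g \<in> Hom (Split_r C) t u"
  obtain X e Y d f0 where s: "s = (X, e)" "t = (Y, d)" "f = ((X, e), f0, (Y, d))"
    "restriction_idempotent C X e" "restriction_idempotent C Y d"
    and fh: "f0 \<in> Hom C X Y" "e \<cdot> f0 = f0" "f0 \<cdot> d = f0"
    using Hom_Split_rE[OF f] by metis
  obtain Z c g0 where t: "u = (Z, c)" "g = ((Y, d), g0, (Z, c))" "restriction_idempotent C Z c"
    and gh: "g0 \<in> Hom C Y Z" "d \<cdot> g0 = g0" "g0 \<cdot> c = g0"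
    using Hom_Split_rE[OF g] s(2) by (metis prod.inject)
  note eh = s(4)[THEN restriction_idempotent_Hom] t(3)[THEN restriction_idempotent_Hom]
  show "Comp (Split_r C) f g \<in> Hom (Split_r C) s u"
    using s t Comp_in_Hom[OF fh(1) gh(1)] Comp_assoc[OF eh(1) fh(1) gh(1)]
      Comp_assoc[OF fh(1) gh(1) eh(2)] fh gh
    by (simp add: Hom_Split_r)
  show "Comp (Split_r C) f (Rst (Split_r C) g) =
      Comp (Split_r C) (Rst (Split_r C) (Comp (Split_r C) f g)) f"
    using s t R4[OF fh(1) gh(1)] by simp
next
  fix f s t
  assume f: "f \<in> Hom (Split_r C) s t"
  then show "Comp (Split_r C) (Ident (Split_r C) s) f = f"
    "Comp (Split_r C) f (Ident (Split_r C) t) = f"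
    "Comp (Split_r C) (Rst (Split_r C) f) f = f"
    by (auto elim!: Hom_Split_rE simp: R1)
  from f show "Rst (Split_r C) f \<in> Hom (Split_r C) s s"
    by (auto elim!: Hom_Split_rE intro!: Hom_Split_rI Rst_in_Hom Rst_below_idempotent)
next
  fix f g h s t u v
  assume "f \<in> Hom (Split_r C) s t" "g \<in> Hom (Split_r C) t u" "h \<in> Hom (Split_r C) u v"
  then show "Comp (Split_r C) (Comp (Split_r C) f g) h = Comp (Split_r C) f (Comp (Split_r C) g h)"
    by (auto elim!: Hom_Split_rE simp: Comp_assoc)
next
  fix f g s t u
  assume "f \<in> Hom (Split_r C) s t" "g \<in> Hom (Split_r C) s u"
  then show "Comp (Split_r C) (Rst (Split_r C) f) (Rst (Split_r C) g) =
      Comp (Split_r C) (Rst (Split_r C) g) (Rst (Split_r C) f)"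
    "Rst (Split_r C) (Comp (Split_r C) (Rst (Split_r C) f) g) =
      Comp (Split_r C) (Rst (Split_r C) f) (Rst (Split_r C) g)"
    by (auto elim!: Hom_Split_rE simp: R2 R3)
qed

end

section \<open>The restriction functor induced between the splittings\<close>

context restriction_functor
begin

lemma amap_restriction_idempotent:
  "restriction_idempotent E X e \<Longrightarrow> restriction_idempotent B (omap p X) (amap p e)"
  using amap_in_Hom amap_Rst by (metis restriction_idempotent_def)

lemma restriction_functor_Split_r:
  "restriction_functor (Split_r E) (Split_r B) (Split_r_map p)"
proof (intro restriction_functor.intro restriction_functor_axioms.intro)
  show "restriction_category (Split_r E)" "restriction_category (Split_r B)"
    by (fact E.restriction_category_Split_r B.restriction_category_Split_r)+
next
  fix s assume "s \<in> Obj (Split_r E)"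
  then show "omap (Split_r_map p) s \<in> Obj (Split_r B)"
    "amap (Split_r_map p) (Ident (Split_r E) s) = Ident (Split_r B) (omap (Split_r_map p) s)"
    by (auto simp: omap_in_Obj amap_restriction_idempotent)
next
  fix f s t assume f: "f \<in> Hom (Split_r E) s t"
  then obtain X e Y d f0 where s: "s = (X, e)" "t = (Y, d)" "f = ((X, e), f0, (Y, d))"
    "restriction_idempotent E X e" "restriction_idempotent E Y d"
    and fh: "f0 \<in> Hom E X Y" "e \<cdot>\<^bsub>E\<^esub> f0 = f0" "f0 \<cdot>\<^bsub>E\<^esub> d = f0"
    using E.Hom_Split_rE[OF f] by metis
  note eh = s(4,5)[THEN E.restriction_idempotent_Hom]
  show "amap (Split_r_map p) f \<in> Hom (Split_r B) (omap (Split_r_map p) s) (omap (Split_r_map p) t)"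
    using s fh amap_restriction_idempotent amap_in_Hom[OF fh(1)]
      amap_Comp[OF eh(1) fh(1)] amap_Comp[OF fh(1) eh(2)]
    by (simp add: B.Hom_Split_r)
  show "amap (Split_r_map p) (Rst (Split_r E) f) = Rst (Split_r B) (amap (Split_r_map p) f)"
    using s fh amap_Rst by simp
next
  fix f g s t u assume "f \<in> Hom (Split_r E) s t" "g \<in> Hom (Split_r E) t u"
  then show "amap (Split_r_map p) (Comp (Split_r E) f g) =
      Comp (Split_r B) (amap (Split_r_map p) f) (amap (Split_r_map p) g)"
    by (auto elim!: E.Hom_Split_rE simp: amap_Comp)
qed

section \<open>Prone arrows in the splitting\<close>

lemma proneD:
  assumes "prone E B p X' X f'" "g \<in> Hom E Y X" "h \<in> Hom B (omap p Y) (omap p X')"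
    "precise B h (amap p f') (amap p g)"
  shows "\<exists>!k. k \<in> Hom E Y X' \<and> amap p k = h \<and> precise E k f' g"
proof -
  have "Y \<in> Obj E"
    using E.Hom_Obj[OF assms(2)] by simp
  with assms show ?thesis
    unfolding prone_def by blast
qed

text \<open>In the base, \<open>amap p k\<close> is a precise factorization of itself through
  \<open>amap p d\<close>. Lifting it gives some \<open>l\<close> with
  \<open>l \<cdot> d = k\<close>, so \<open>k\<close> absorbs \<open>d\<close> because
  \<open>d\<close> is idempotent.\<close>

lemma prone_idempotent_absorb:
  assumes pr: "prone E B p X X d" and d: "restriction_idempotent E X d"
    and k: "k \<in> Hom E Y X" and kd: "amap p k \<cdot>\<^bsub>B\<^esub> amap p d = amap p k"
  shows "k \<cdot>\<^bsub>E\<^esub> d = k"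
proof -
  note dh = E.restriction_idempotent_Hom[OF d]
  obtain l where l: "l \<in> Hom E Y X" and "precise E l d k"
    using proneD[OF pr k amap_in_Hom[OF k]] kd by (auto simp: precise_def)
  then have "l \<cdot>\<^bsub>E\<^esub> d = k"
    by (simp add: precise_def)
  then show ?thesis
    using E.Comp_assoc[OF l dh dh] E.restriction_idempotent_idem[OF d] by simp
qed

text \<open>Common core of the fibration and admissibility proofs. The premise \<open>absorb\<close>
  isolates what they establish differently. Its conditions are those satisfied by a lift
  \<open>k\<close> through \<open>f'\<close> of a map \<open>g\<close> that absorbs
  \<open>e\<close>, with \<open>g\<close> written as \<open>k \<cdot> f'\<close>.\<close>

lemma prone_Split_r:
  assumes pr: "prone E B p X' X f'"
    and d: "restriction_idempotent E X' d" and e: "restriction_idempotent E X e"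
    and pf: "amap p d \<cdot>\<^bsub>B\<^esub> amap p f' = amap p f'" "amap p f' \<cdot>\<^bsub>B\<^esub> amap p e = amap p f'"
    and absorb: "\<And>Y k. k \<in> Hom E Y X' \<Longrightarrow> amap p k \<cdot>\<^bsub>B\<^esub> amap p d = amap p k \<Longrightarrow>
      k \<cdot>\<^bsub>E\<^esub> f' \<cdot>\<^bsub>E\<^esub> e = k \<cdot>\<^bsub>E\<^esub> f' \<Longrightarrow> Rst E (k \<cdot>\<^bsub>E\<^esub> f') = Rst E k \<Longrightarrow> k \<cdot>\<^bsub>E\<^esub> d = k"
  shows "prone (Split_r E) (Split_r B) (Split_r_map p) (X', d) (X, e)
           ((X', d), d \<cdot>\<^bsub>E\<^esub> f' \<cdot>\<^bsub>E\<^esub> e, (X, e))"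
    and "amap p (d \<cdot>\<^bsub>E\<^esub> f' \<cdot>\<^bsub>E\<^esub> e) = amap p f'"
proof -
  note dh = E.restriction_idempotent_Hom[OF d] and eh = E.restriction_idempotent_Hom[OF e]
  have f': "f' \<in> Hom E X' X"
    using pr by (simp add: prone_def)
  note df = E.Comp_in_Hom[OF dh f']
  note dfe = E.Comp_in_Hom[OF df eh]
  note fe = E.Comp_in_Hom[OF f' eh]
  show amap: "amap p (d \<cdot>\<^bsub>E\<^esub> f' \<cdot>\<^bsub>E\<^esub> e) = amap p f'"
    using amap_Comp[OF df eh] amap_Comp[OF dh f'] pf by simp
  have "d \<cdot>\<^bsub>E\<^esub> (d \<cdot>\<^bsub>E\<^esub> f' \<cdot>\<^bsub>E\<^esub> e) = d \<cdot>\<^bsub>E\<^esub> f' \<cdot>\<^bsub>E\<^esub> e"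
    using E.Comp_assoc[OF dh df eh] E.Comp_assoc[OF dh dh f'] E.restriction_idempotent_idem[OF d]
    by simp
  moreover have "d \<cdot>\<^bsub>E\<^esub> f' \<cdot>\<^bsub>E\<^esub> e \<cdot>\<^bsub>E\<^esub> e = d \<cdot>\<^bsub>E\<^esub> f' \<cdot>\<^bsub>E\<^esub> e"
    using E.Comp_assoc[OF df eh eh] E.restriction_idempotent_idem[OF e] by simp
  ultimately have hom: "((X', d), d \<cdot>\<^bsub>E\<^esub> f' \<cdot>\<^bsub>E\<^esub> e, (X, e)) \<in> Hom (Split_r E) (X', d) (X, e)"
    using E.Hom_Split_rI[OF d e dfe] by simp
  \<comment> \<open>For maps into \<open>(X', d)\<close> the compression by \<open>d\<close> is
    invisible, so only the factor \<open>e\<close> separates this arrow from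
    \<open>f'\<close>.\<close>
  have factor: "k \<cdot>\<^bsub>E\<^esub> (d \<cdot>\<^bsub>E\<^esub> f' \<cdot>\<^bsub>E\<^esub> e) = k \<cdot>\<^bsub>E\<^esub> (f' \<cdot>\<^bsub>E\<^esub> e)"
    if k: "k \<in> Hom E Y X'" and kd: "k \<cdot>\<^bsub>E\<^esub> d = k" for k Y
    using E.Comp_assoc[OF dh f' eh] E.Comp_assoc[OF k dh fe] kd by simp
  have "\<exists>!K. K \<in> Hom (Split_r E) s (X', d) \<and> amap (Split_r_map p) K = H \<and>
          precise (Split_r E) K ((X', d), d \<cdot>\<^bsub>E\<^esub> f' \<cdot>\<^bsub>E\<^esub> e, (X, e)) G"
    if G: "G \<in> Hom (Split_r E) s (X, e)"
      and H: "H \<in> Hom (Split_r B) (omap (Split_r_map p) s) (omap (Split_r_map p) (X', d))"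
      and prec: "precise (Split_r B) H
        (amap (Split_r_map p) ((X', d), d \<cdot>\<^bsub>E\<^esub> f' \<cdot>\<^bsub>E\<^esub> e, (X, e))) (amap (Split_r_map p) G)"
    for s G H
  proof -
    obtain Y c g where s: "s = (Y, c)" and Gg: "G = ((Y, c), g, (X, e))"
      and c: "restriction_idempotent E Y c"
      and g: "g \<in> Hom E Y X" "c \<cdot>\<^bsub>E\<^esub> g = g" "g \<cdot>\<^bsub>E\<^esub> e = g"
      using E.Hom_Split_rE[OF G] by (metis prod.inject)
    obtain h where Hh: "H = ((omap p Y, amap p c), h, (omap p X', amap p d))"
      and h: "h \<in> Hom B (omap p Y) (omap p X')" "h \<cdot>\<^bsub>B\<^esub> amap p d = h"
      using H by (auto simp: s B.Hom_Split_r)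
    \<comment> \<open>The compressed arrow and \<open>f'\<close> have the same image under
      \<open>p\<close>, so the lifting problem in the splitting is already one for
      \<open>f'\<close>.\<close>
    have "precise B h (amap p f') (amap p g)"
      using prec by (simp add: precise_def Hh Gg amap)
    from proneD[OF pr g(1) h(1) this] obtain k
      where k: "k \<in> Hom E Y X'" "amap p k = h" "precise E k f' g"
        and uniq: "\<And>l. l \<in> Hom E Y X' \<Longrightarrow> amap p l = h \<Longrightarrow> precise E l f' g \<Longrightarrow> l = k"
      by blast
    have kf: "k \<cdot>\<^bsub>E\<^esub> f' = g" "Rst E g = Rst E k"
      using k(3) by (simp_all add: precise_def)
    have kd: "k \<cdot>\<^bsub>E\<^esub> d = k"
      using absorb[OF k(1)] k(2) h(2) kf g(3) by simp
    have ck: "c \<cdot>\<^bsub>E\<^esub> k = k"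
      by (rule E.precise_left_absorb[OF c g(1,2) k(1) kf(2)])
    have kfe: "k \<cdot>\<^bsub>E\<^esub> (d \<cdot>\<^bsub>E\<^esub> f' \<cdot>\<^bsub>E\<^esub> e) = g"
      using factor[OF k(1) kd] E.Comp_assoc[OF k(1) f' eh] kf(1) g(3) by simp
    show ?thesis
    proof (rule ex1I[of _ "((Y, c), k, (X', d))"])
      show "((Y, c), k, (X', d)) \<in> Hom (Split_r E) s (X', d) \<and>
          amap (Split_r_map p) ((Y, c), k, (X', d)) = H \<and>
          precise (Split_r E) ((Y, c), k, (X', d)) ((X', d), d \<cdot>\<^bsub>E\<^esub> f' \<cdot>\<^bsub>E\<^esub> e, (X, e)) G"
        using E.Hom_Split_rI[OF c d k(1) ck kd] kfe kf(2)
        by (simp add: s Hh Gg k(2) precise_def)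
    next
      fix L
      assume L: "L \<in> Hom (Split_r E) s (X', d) \<and> amap (Split_r_map p) L = H \<and>
          precise (Split_r E) L ((X', d), d \<cdot>\<^bsub>E\<^esub> f' \<cdot>\<^bsub>E\<^esub> e, (X, e)) G"
      then obtain l where Ll: "L = ((Y, c), l, (X', d))"
        and l: "l \<in> Hom E Y X'" "l \<cdot>\<^bsub>E\<^esub> d = l"
        by (auto simp: s E.Hom_Split_r)
      have lh: "amap p l = h" and lg: "l \<cdot>\<^bsub>E\<^esub> (d \<cdot>\<^bsub>E\<^esub> f' \<cdot>\<^bsub>E\<^esub> e) = g" "Rst E g = Rst E l"
        using L by (simp_all add: Ll Hh Gg precise_def)
      \<comment> \<open>A competing lift in the splitting is turned into a lift through
        \<open>f'\<close> by removing first \<open>d\<close>, then \<open>e\<close>; uniqueness for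
        \<open>f'\<close> then applies.\<close>
      have lfe: "l \<cdot>\<^bsub>E\<^esub> (f' \<cdot>\<^bsub>E\<^esub> e) = g"
        using factor[OF l] lg(1) by simp
      then have "l \<cdot>\<^bsub>E\<^esub> f' = g"
        using E.precise_right_absorb[OF f' l(1) e] lg(2) E.Comp_assoc[OF l(1) f' eh] by simp
      then show "L = ((Y, c), k, (X', d))"
        using uniq[OF l(1) lh] lg(2) by (simp add: precise_def Ll)
    qed
  qed
  then show "prone (Split_r E) (Split_r B) (Split_r_map p) (X', d) (X, e)
      ((X', d), d \<cdot>\<^bsub>E\<^esub> f' \<cdot>\<^bsub>E\<^esub> e, (X, e))"
    unfolding prone_def using hom by blast
qed

section \<open>The two fibration properties of the splitting\<close>

lemma latent_fibration_Split_r: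
  assumes lf: "latent_fibration E B p" and ad: "admissible E B p"
  shows "latent_fibration (Split_r E) (Split_r B) (Split_r_map p)"
  unfolding latent_fibration_def
proof (intro conjI ballI restriction_functor_Split_r)
  fix s t F
  assume s: "s \<in> Obj (Split_r E)" and F: "F \<in> Hom (Split_r B) t (omap (Split_r_map p) s)"
  obtain X e where Xe: "s = (X, e)" "X \<in> Obj E" and e: "restriction_idempotent E X e"
    using s by auto
  obtain A d where t: "t = (A, d)"
    by (cases t)
  obtain f where Ff: "F = ((A, d), f, (omap p X, amap p e))"
    and d: "restriction_idempotent B A d"
    and f: "f \<in> Hom B A (omap p X)" "d \<cdot>\<^bsub>B\<^esub> f = f" "f \<cdot>\<^bsub>B\<^esub> amap p e = f"
    using F by (auto simp: t Xe(1) B.Hom_Split_r)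
  have "A \<in> Obj B"
    using B.Hom_Obj[OF f(1)] by simp
  \<comment> \<open>The underlying map \<open>f\<close> is lifted first, regardless of the
    idempotents at its ends.\<close>
  then obtain X' f' where X': "X' \<in> Obj E" "omap p X' = A"
    and pr: "prone E B p X' X f'" and pf: "amap p f' = f"
    using lf Xe(2) f(1) unfolding latent_fibration_def by blast
  \<comment> \<open>As \<open>X'\<close> lies over \<open>A\<close>, admissibility at
    \<open>X'\<close> supplies an idempotent over \<open>d\<close>. Together they form the domain
    \<open>(X', d')\<close> of the lift, and proneness of \<open>d'\<close> yields the absorption
    law.\<close>
  obtain d' where d': "restriction_idempotent E X' d'" and prd: "prone E B p X' X' d'"
    and pd: "amap p d' = d"
    using ad X' d unfolding admissible_def by blast
  have absorb: "k \<cdot>\<^bsub>E\<^esub> d' = k"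
    if "k \<in> Hom E Y X'" "amap p k \<cdot>\<^bsub>B\<^esub> amap p d' = amap p k" for Y k
    by (rule prone_idempotent_absorb[OF prd d' that])
  have absorbs: "amap p d' \<cdot>\<^bsub>B\<^esub> amap p f' = amap p f'" "amap p f' \<cdot>\<^bsub>B\<^esub> amap p e = amap p f'"
    using f pd pf by simp_all
  let ?F = "((X', d'), d' \<cdot>\<^bsub>E\<^esub> f' \<cdot>\<^bsub>E\<^esub> e, (X, e))"
  have "prone (Split_r E) (Split_r B) (Split_r_map p) (X', d') s ?F"
    unfolding Xe(1) by (rule prone_Split_r(1)[OF pr d' e absorbs absorb])
  moreover have "amap p (d' \<cdot>\<^bsub>E\<^esub> f' \<cdot>\<^bsub>E\<^esub> e) = amap p f'"
    by (rule prone_Split_r(2)[OF pr d' e absorbs absorb])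
  then have "amap (Split_r_map p) ?F = F"
    by (simp add: Ff X'(2) pd pf)
  moreover have "(X', d') \<in> Obj (Split_r E)" "omap (Split_r_map p) (X', d') = t"
    using X' d' by (simp_all add: t pd)
  ultimately show "\<exists>S\<in>Obj (Split_r E). \<exists>F'. omap (Split_r_map p) S = t \<and>
      prone (Split_r E) (Split_r B) (Split_r_map p) S s F' \<and> amap (Split_r_map p) F' = F"
    by blast
qed

text \<open>The witness \<open>e \<cdot> c' \<cdot> e\<close> is a product of restriction
  idempotents, hence one itself. Here the domain idempotent is the given \<open>e\<close>, which
  need not be prone, so absorption has to come from proneness of \<open>c'\<close>.\<close>

lemma admissible_Split_r:
  assumes ad: "admissible E B p"
  shows "admissible (Split_r E) (Split_r B) (Split_r_map p)"
  unfolding admissible_def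
proof (intro conjI ballI allI impI restriction_functor_Split_r)
  fix s F
  assume s: "s \<in> Obj (Split_r E)"
    and F: "restriction_idempotent (Split_r B) (omap (Split_r_map p) s) F"
  obtain X e where Xe: "s = (X, e)" "X \<in> Obj E" and e: "restriction_idempotent E X e"
    using s by auto
  obtain c where Fc: "F = ((omap p X, amap p e), c, (omap p X, amap p e))"
    and c: "restriction_idempotent B (omap p X) c" "amap p e \<cdot>\<^bsub>B\<^esub> c = c"
    using F by (auto simp: Xe(1) B.restriction_idempotent_Split_r)
  obtain c' where c': "restriction_idempotent E X c'" and pr: "prone E B p X X c'"
    and pc: "amap p c' = c"
    using ad Xe(2) c(1) unfolding admissible_def by blast
  note ch = E.restriction_idempotent_Hom[OF c'] and eh = E.restriction_idempotent_Hom[OF e]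
  have ce: "c \<cdot>\<^bsub>B\<^esub> amap p e = c"
    using B.restriction_idempotent_commute[OF amap_restriction_idempotent[OF e] c(1)] c(2) by simp
  have absorb: "k \<cdot>\<^bsub>E\<^esub> e = k"
    if k: "k \<in> Hom E Y X" and ke: "amap p k \<cdot>\<^bsub>B\<^esub> amap p e = amap p k"
      and kce: "k \<cdot>\<^bsub>E\<^esub> c' \<cdot>\<^bsub>E\<^esub> e = k \<cdot>\<^bsub>E\<^esub> c'" and r: "Rst E (k \<cdot>\<^bsub>E\<^esub> c') = Rst E k" for Y k
  proof -
    note kc = E.Comp_in_Hom[OF k ch] and keh = E.Comp_in_Hom[OF k eh]
    \<comment> \<open>Because \<open>e\<close> and \<open>c'\<close> commute, the trailing
      \<open>e\<close> can be moved in front of \<open>c'\<close>.\<close>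
    have kec: "k \<cdot>\<^bsub>E\<^esub> e \<cdot>\<^bsub>E\<^esub> c' = k \<cdot>\<^bsub>E\<^esub> c'"
      using kce E.Comp_assoc[OF k ch eh] E.Comp_assoc[OF k eh ch]
        E.restriction_idempotent_commute[OF c' e] by simp
    have "Rst E (k \<cdot>\<^bsub>E\<^esub> e) = Rst E k"
      using E.Rst_eq_factor[OF k eh ch] kec r by simp
    \<comment> \<open>Both \<open>k \<cdot> e\<close> and \<open>k\<close> are precise lifts of
      \<open>k \<cdot> c'\<close> through \<open>c'\<close>. By \<open>ke\<close> they lie over the
      same base map, so they coincide.\<close>
    then have 1: "precise E (k \<cdot>\<^bsub>E\<^esub> e) c' (k \<cdot>\<^bsub>E\<^esub> c')" and 2: "precise E k c' (k \<cdot>\<^bsub>E\<^esub> c')"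
      using kec r by (simp_all add: precise_def)
    have "precise B (amap p k) (amap p c') (amap p (k \<cdot>\<^bsub>E\<^esub> c'))"
      using amap_Comp[OF k ch] amap_Rst[OF kc] amap_Rst[OF k] r by (simp add: precise_def)
    from proneD[OF pr kc amap_in_Hom[OF k] this] show ?thesis
      using 1 2 k keh amap_Comp[OF k eh] ke by auto
  qed
  have absorbs: "amap p e \<cdot>\<^bsub>B\<^esub> amap p c' = amap p c'" "amap p c' \<cdot>\<^bsub>B\<^esub> amap p e = amap p c'"
    using c(2) ce pc by simp_all
  let ?F = "((X, e), e \<cdot>\<^bsub>E\<^esub> c' \<cdot>\<^bsub>E\<^esub> e, (X, e))"
  have "prone (Split_r E) (Split_r B) (Split_r_map p) s s ?F"
    unfolding Xe(1) by (rule prone_Split_r(1)[OF pr e e absorbs absorb])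
  moreover have "amap p (e \<cdot>\<^bsub>E\<^esub> c' \<cdot>\<^bsub>E\<^esub> e) = amap p c'"
    by (rule prone_Split_r(2)[OF pr e e absorbs absorb])
  then have "amap (Split_r_map p) ?F = F"
    by (simp add: Fc pc)
  moreover have idem: "restriction_idempotent E X (e \<cdot>\<^bsub>E\<^esub> c' \<cdot>\<^bsub>E\<^esub> e)"
    by (intro E.restriction_idempotent_Comp e c')
  have "e \<cdot>\<^bsub>E\<^esub> (e \<cdot>\<^bsub>E\<^esub> c' \<cdot>\<^bsub>E\<^esub> e) = e \<cdot>\<^bsub>E\<^esub> c' \<cdot>\<^bsub>E\<^esub> e"
    using E.Comp_assoc[OF eh E.Comp_in_Hom[OF eh ch] eh] E.Comp_assoc[OF eh eh ch]
      E.restriction_idempotent_idem[OF e] by simp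
  then have "restriction_idempotent (Split_r E) s ?F"
    using e idem by (simp add: Xe(1) E.restriction_idempotent_Split_r)
  ultimately show "\<exists>F'. restriction_idempotent (Split_r E) s F' \<and>
      prone (Split_r E) (Split_r B) (Split_r_map p) s s F' \<and> amap (Split_r_map p) F' = F"
    by blast
qed

end

theorem proposition5p19:
  fixes E :: "('oe, 'me) rcat" and B :: "('ob, 'mb) rcat"
    and p :: "('oe, 'me, 'ob, 'mb) funct"
  assumes "restriction_functor E B p"
    and "latent_fibration E B p" and "admissible E B p"
  shows "latent_fibration (Split_r E) (Split_r B) (Split_r_map p) \<and>
         admissible (Split_r E) (Split_r B) (Split_r_map p)"
  using assms restriction_functor.latent_fibration_Split_r restriction_functor.admissible_Split_r
  by blast

end
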